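(* The graph $OTIS(BF(4,4))$ is not Hamiltonian.
   Context: All graphs are finite, simple and undirected. The bowtie graph $BF(4,4)$ consists of two 4-cycles sharing exactly one vertex: its vertex set is $\{1,2,\dots,7\}$, the vertices $1,2,3,4$ form in this cyclic order a 4-cycle, the vertices $4,5,6,7$ form in this cyclic order a 4-cycle, and there are no other edges. For a graph $G$, the graph $OTIS(G)$ has vertex set $\{\langle u,v\rangle : u,v\in V(G)\}$ and edge set $$\{(\langle v,u\rangle,\langle v,u'\rangle) : v\in V(G),\ (u,u')\in E(G)\}\ \cup\ \{(\langle v,u\rangle,\langle u,v\rangle) : u,v\in V(G),\ u\ne v\}.$$ A graph is Hamiltonian if it has a cycle passing through every vertex exactly once. *)

theory Defs
  imports "Graph_Theory.Graph_Theory"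
begin

text \<open>
  Simple undirected graphs are rendered as in the library, by the locale \<^locale>\<open>pair_graph\<close>: an
  undirected edge \<open>{u, v}\<close> is represented by the two arcs \<open>(u, v)\<close> and \<open>(v, u)\<close>.
\<close>

definition bowtie44 :: "nat pair_pre_digraph" where
  "bowtie44 =
    \<lparr> pverts = {1..7},
      parcs = symcl ({(1, 2), (2, 3), (3, 4), (4, 1)} \<union> {(4, 5), (5, 6), (6, 7), (7, 4)}) \<rparr>"

definition OTIS :: "'a pair_pre_digraph \<Rightarrow> ('a \<times> 'a) pair_pre_digraph" where
  "OTIS G =
    \<lparr> pverts = pverts G \<times> pverts G,
      parcs = {((v, u), (v, u')) | v u u'. v \<in> pverts G \<and> (u, u') \<in> parcs G}
        \<union> {((v, u), (u, v)) | u v. u \<in> pverts G \<and> v \<in> pverts G \<and> u \<noteq> v} \<rparr>"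

text \<open>
  The library's \<^const>\<open>pre_digraph.cycle\<close> consists of arcs, so in a symmetric digraph it also admits
  the degenerate closed walk \<open>u, v, u\<close> of length 2, which is not a cycle of the undirected graph;
  hence the bound on the length. The distinctness of the vertices is part of
  \<^const>\<open>pre_digraph.cycle\<close>, and the tails of the arcs are the vertices of the cycle.
\<close>

definition hamiltonian :: "'a pair_pre_digraph \<Rightarrow> bool" where
  "hamiltonian G \<longleftrightarrow>
    (\<exists>p. pre_digraph.cycle (with_proj G) p \<and> 3 \<le> length p \<and> fst ` set p = pverts G)"

lemma pair_graph_bowtie44: "pair_graph bowtie44"
  by unfold_locales
    (auto simp: bowtie44_def symcl_def symmetric_def intro!: symI)

lemma pair_graph_OTIS:
  assumes "pair_graph G"
  shows "pair_graph (OTIS G)"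
proof -
  interpret pair_graph G by fact
  have fin: "finite (pverts (OTIS G))"
    by (simp add: OTIS_def pair_finite_verts)
  have sub: "parcs (OTIS G) \<subseteq> pverts (OTIS G) \<times> pverts (OTIS G)"
    by (auto simp: OTIS_def dest: in_arcsD1 in_arcsD2)
  have "sym (parcs G)"
    using pair_sym_arcs by (simp add: symmetric_def)
  then have sym: "sym (parcs (OTIS G))"
    by (auto simp: OTIS_def sym_def)
  have irr: "fst e \<noteq> snd e" if "e \<in> parcs (OTIS G)" for e
    using that pair_no_loops by (force simp: OTIS_def)
  show ?thesis
  proof unfold_locales
    show "finite (parcs (OTIS G))"
      using finite_subset[OF sub] fin by blast
  qed (use fin sub sym irr in \<open>auto simp: symmetric_def\<close>)
qed

end

theory Submission
  imports Defs
begin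

text \<open>
  A Hamiltonian cycle is a connected 2-factor, and the degree conditions alone nearly determine it.
  Write \<open>h\<close> for the common vertex of the two 4-cycles and \<open>h, a, b, c\<close> for one of them. The diagonal
  vertices \<open>(a, a)\<close>, \<open>(b, b)\<close>, \<open>(c, c)\<close> have degree 2. Following the forced edges inside
  \<open>{a, b, c} \<times> {a, b, c}\<close> shows that \<open>(a, h)\<close> or \<open>(c, h)\<close> has both of its cycle edges
  going into that block, since otherwise the cycle would contain a 4-cycle in the copy with index
  \<open>b\<close>. By symmetry this happens at \<open>(a, h)\<close> and, for the other 4-cycle \<open>h, d, e, f\<close>, at
  \<open>(d, h)\<close>. Then the edges in the copy with index \<open>h\<close> are forced, which uses up \<open>(c, h)\<close> as
  well, and in turn the copies with indices \<open>a\<close> and \<open>c\<close> contain the paths \<open>d, e, f\<close>. Hence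
  neither \<open>(e, a)\<close> nor \<open>(e, c)\<close> uses its swap edge, and the copy with index \<open>e\<close> contains
  the 4-cycle \<open>h, a, b, c\<close>, a contradiction.
\<close>

text \<open>\<open>N v\<close> holds the two neighbours of \<open>v\<close> along the cycle, with
  orientation and base point forgotten. Connectedness takes the form \<open>closed_eq\<close>, which
  refutes any cycle that closes too early.\<close>

locale connected_two_factor =
  fixes G :: "'a pair_pre_digraph" and N :: "'a \<Rightarrow> 'a set"
  assumes card_nbrs: "v \<in> pverts G \<Longrightarrow> card (N v) = 2"
    and nbrs_arcs: "w \<in> N v \<Longrightarrow> (v, w) \<in> parcs G"
    and nbrs_sym: "w \<in> N v \<Longrightarrow> v \<in> N w"
    and closed_eq: "\<lbrakk>S \<subseteq> pverts G; S \<noteq> {}; \<And>v. v \<in> S \<Longrightarrow> N v \<subseteq> S\<rbrakk> \<Longrightarrow> S = pverts G"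
begin

lemma nbrs_commute: "w \<in> N v \<longleftrightarrow> v \<in> N w"
  using nbrs_sym by blast

lemma nbrs_eqI:
  assumes "v \<in> pverts G" "v \<in> N x" "v \<in> N y" "x \<noteq> y"
  shows "N v = {x, y}"
proof -
  have "finite (N v)"
    using card_nbrs[OF assms(1)] card.infinite by fastforce
  moreover have "{x, y} \<subseteq> N v"
    using assms(2,3) nbrs_sym by blast
  ultimately show ?thesis
    using assms(4) card_nbrs[OF assms(1)] card_subset_eq[of "N v" "{x, y}"] by simp
qed

lemma nbrs_eq_if_subset:
  assumes "v \<in> pverts G" "N v \<subseteq> {x, y}"
  shows "N v = {x, y}"
proof (rule card_subset_eq)
  show "card (N v) = card {x, y}"
    using card_nbrs[OF assms(1)] card_mono[OF _ assms(2)] card_insert_le_m1[of 2 "{y}" x]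
    by (simp add: le_antisym)
qed (use assms in auto)

end

section \<open>From Hamiltonian cycles to connected 2-factors\<close>

lemma cas_closed:
  assumes "pre_digraph.cas (with_proj G) u p w" "u \<in> S"
    and "\<And>x y. (x, y) \<in> set p \<Longrightarrow> x \<in> S \<Longrightarrow> y \<in> S"
  shows "fst ` set p \<subseteq> S \<and> w \<in> S"
  using assms
proof (induction p arbitrary: u)
  case (Cons e p)
  obtain x y where e: "e = (x, y)"
    by fastforce
  with Cons.prems have x: "x = u" and cas: "pre_digraph.cas (with_proj G) y p w"
    by (simp_all add: pre_digraph.cas.simps)
  have "y \<in> S"
    using Cons.prems(2,3) e x by auto
  with Cons.IH[OF cas] Cons.prems(2,3) show ?case
    by (auto simp: e x)
qed (simp add: pre_digraph.cas.simps)

lemma cas_verts: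
  assumes "pre_digraph.cas (with_proj G) u p w"
  shows "pre_digraph.awalk_verts (with_proj G) u p = u # map snd p"
    and "map fst p @ [w] = u # map snd p"
  using assms
  by (induction p arbitrary: u) (auto simp: pre_digraph.cas.simps pre_digraph.awalk_verts.simps)

text \<open>Each vertex is the tail of one arc of the cycle and the head of one. The other ends of
  these arcs become its neighbours; they differ because the length is at least 3.\<close>

lemma hamiltonian_imp_connected_two_factor:
  assumes "hamiltonian G" "pair_graph G"
  obtains N where "connected_two_factor G N"
proof -
  interpret pair_graph G by fact
  obtain p where cyc: "pre_digraph.cycle (with_proj G) p"
    and len: "3 \<le> length p" and verts: "fst ` set p = pverts G"
    using assms(1) unfolding hamiltonian_def by blast
  obtain u where aw: "pre_digraph.awalk (with_proj G) u p u"
    and dist: "distinct (tl (pre_digraph.awalk_verts (with_proj G) u p))"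
    using cyc unfolding pre_digraph.cycle_def by blast
  have cas: "pre_digraph.cas (with_proj G) u p u" and arcs: "set p \<subseteq> parcs G"
    using aw by (auto simp: pre_digraph.awalk_def)
  have snd_dist: "distinct (map snd p)"
    using dist cas_verts(1)[OF cas] by simp
  have eq: "map fst p @ [u] = u # map snd p"
    by (rule cas_verts(2)[OF cas])
  \<comment> \<open>Tails and heads agree up to rotation, so distinctness passes from heads to
    tails.\<close>
  have mset_eq: "mset (map fst p) = mset (map snd p)"
    using arg_cong[OF eq, of mset] by simp
  then have fst_dist: "distinct (map fst p)"
    using snd_dist mset_eq_imp_distinct_iff by blast
  have snd_verts: "snd ` set p = pverts G"
    using mset_eq_setD[OF mset_eq] verts by simp
  have card_verts: "3 \<le> card (pverts G)"
    using len distinct_card[OF fst_dist] verts by simp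
  have succ_unique: "y = y'" if "(x, y) \<in> set p" "(x, y') \<in> set p" for x y y'
    using that fst_dist inj_onD[of fst "set p" "(x, y)" "(x, y')"] by (simp add: distinct_map)
  have pred_unique: "x = x'" if "(x, y) \<in> set p" "(x', y) \<in> set p" for x x' y
    using that snd_dist inj_onD[of snd "set p" "(x, y)" "(x', y)"] by (simp add: distinct_map)
  \<comment> \<open>Closure under successors is enough: from a point of \<open>S\<close> the walk
    runs on to its base point \<open>u\<close>, and from \<open>u\<close> it passes every
    vertex.\<close>
  have closed: "S = pverts G"
    if S: "S \<subseteq> pverts G" "S \<noteq> {}" "\<And>x y. (x, y) \<in> set p \<Longrightarrow> x \<in> S \<Longrightarrow> y \<in> S" for S
  proof -
    obtain x y where xy: "x \<in> S" "(x, y) \<in> set p"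
      using S(1,2) verts by (metis all_not_in_conv imageE prod.collapse subsetD)
    then obtain q r where p: "p = q @ (x, y) # r"
      by (meson split_list)
    have "pre_digraph.cas (with_proj G) y r u"
      using cas unfolding p
      by (auto simp: pre_digraph.cas_append_iff pre_digraph.cas.simps)
    moreover have "y \<in> S"
      using S(3) xy by blast
    ultimately have "u \<in> S"
      using cas_closed[of G y r u S] S(3) by (auto simp: p)
    then have "fst ` set p \<subseteq> S"
      using cas_closed[OF cas] S(3) by blast
    then show ?thesis
      using S(1) verts by blast
  qed
  define N where "N v = {w. (v, w) \<in> set p \<or> (w, v) \<in> set p}" for v
  have "connected_two_factor G N"
  proof
    fix v assume v: "v \<in> pverts G"
    then obtain s r where sr: "(v, s) \<in> set p" "(r, v) \<in> set p"
      using verts snd_verts by (metis imageE prod.collapse)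
    have "s \<noteq> r"
    proof
      assume "s = r"
      have "{v, s} = pverts G"
      proof (rule closed)
        show "{v, s} \<subseteq> pverts G"
          using sr(1) v snd_verts by force
      qed (use sr \<open>s = r\<close> succ_unique in auto)
      then have "card (pverts G) \<le> 2"
        using card_insert_le_m1[of 2 "{s}" v] by simp
      with card_verts show False by simp
    qed
    moreover have "N v = {s, r}"
      using sr succ_unique pred_unique unfolding N_def by blast
    ultimately show "card (N v) = 2" by simp
  next
    fix v w assume "w \<in> N v"
    then show "(v, w) \<in> parcs G"
      using arcs pair_sym_arcs unfolding N_def by (auto simp: symmetric_def dest: symD)
  next
    fix v w assume "w \<in> N v"
    then show "v \<in> N w"
      unfolding N_def by blast
  next
    fix S assume "S \<subseteq> pverts G" "S \<noteq> {}" "\<And>v. v \<in> S \<Longrightarrow> N v \<subseteq> S"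
    then show "S = pverts G"
      using closed[of S] unfolding N_def by blast
  qed
  then show ?thesis ..
qed

section \<open>Forced edges around one 4-cycle\<close>

text \<open>The neighbours of \<open>h\<close> are left open, so that both 4-cycles of the bowtie
  qualify.\<close>

definition pendant_square :: "'a pair_pre_digraph \<Rightarrow> 'a \<Rightarrow> 'a \<Rightarrow> 'a \<Rightarrow> 'a \<Rightarrow> bool" where
  "pendant_square G h a b c \<longleftrightarrow>
    {h, a, b, c} \<subseteq> pverts G \<and> distinct [h, a, b, c] \<and>
    parcs G `` {a} = {b, h} \<and> parcs G `` {b} = {a, c} \<and> parcs G `` {c} = {b, h}"

lemma pendant_square_commute: "pendant_square G h a b c \<longleftrightarrow> pendant_square G h c b a"
  unfolding pendant_square_def by (auto simp only: insert_commute distinct.simps list.set)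

locale otis_two_factor = connected_two_factor "OTIS G" N
  for G :: "'a pair_pre_digraph" and N
begin

lemma verts_iff: "(v, u) \<in> pverts (OTIS G) \<longleftrightarrow> v \<in> pverts G \<and> u \<in> pverts G"
  by (simp add: OTIS_def)

lemma nbrs_otis:
  shows "N (v, u) \<subseteq> Pair v ` (parcs G `` {u}) \<union> {(u, v)}"
    and "N (v, v) \<subseteq> Pair v ` (parcs G `` {v})"
  by (auto simp: OTIS_def dest!: nbrs_arcs)

lemma square_nbrs:
  assumes "pendant_square G h a b c"
  shows "N (v, a) \<subseteq> {(v, b), (v, h), (a, v)}"
    and "N (v, b) \<subseteq> {(v, a), (v, c), (b, v)}"
    and "N (v, c) \<subseteq> {(v, b), (v, h), (c, v)}"
  using assms nbrs_otis(1)[of v a] nbrs_otis(1)[of v b] nbrs_otis(1)[of v c]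
  by (simp_all add: pendant_square_def insert_commute)

lemma square_diagonal:
  assumes "pendant_square G h a b c"
  shows "N (a, a) = {(a, b), (a, h)}" "N (b, b) = {(b, a), (b, c)}" "N (c, c) = {(c, b), (c, h)}"
  using assms nbrs_otis(2)[of a] nbrs_otis(2)[of b] nbrs_otis(2)[of c]
  by (simp_all add: pendant_square_def verts_iff nbrs_eq_if_subset)

text \<open>The four given edges close up to a 4-cycle in copy \<open>v\<close>, and
  \<open>(h, h)\<close> lies outside it since \<open>v \<noteq> h\<close>.\<close>

lemma no_square:
  assumes sq: "pendant_square G h a b c" and v: "v \<in> pverts G" "v \<noteq> h"
    and "N (v, b) = {(v, a), (v, c)}" "(v, a) \<in> N (v, h)" "(v, c) \<in> N (v, h)"
  shows False
proof -
  let ?S = "{(v, a), (v, b), (v, c), (v, h)}"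
  have verts: "h \<in> pverts G" "a \<in> pverts G" "b \<in> pverts G" "c \<in> pverts G"
    and dist: "distinct [h, a, b, c]"
    using sq by (auto simp: pendant_square_def)
  have va: "N (v, a) = {(v, b), (v, h)}"
    using assms(4,5) v verts dist by (intro nbrs_eqI) (auto simp: verts_iff)
  have vc: "N (v, c) = {(v, b), (v, h)}"
    using assms(4,6) v verts dist by (intro nbrs_eqI) (auto simp: verts_iff)
  have vh: "N (v, h) = {(v, a), (v, c)}"
    using va vc v verts dist by (intro nbrs_eqI) (auto simp: verts_iff)
  have "?S \<subseteq> pverts (OTIS G)" "\<forall>w \<in> ?S. N w \<subseteq> ?S"
    using va vc vh assms(4) v verts by (simp_all add: verts_iff)
  then have "?S = pverts (OTIS G)"
    by (intro closed_eq) blast+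
  moreover have "(h, h) \<in> pverts (OTIS G)" "(h, h) \<notin> ?S"
    using verts v(2) by (simp_all add: verts_iff)
  ultimately show False
    by simp
qed

text \<open>Deprived of \<open>(b, h)\<close>, the vertex \<open>(b, c)\<close> takes its swap edge.
  With the edge from \<open>(c, c)\<close> this fills \<open>(c, b)\<close>, so
  \<open>(c, a)\<close> must use \<open>(c, h)\<close>, which is then full too.\<close>

lemma square_block_forced:
  assumes sq: "pendant_square G h a b c" and unused: "(b, c) \<notin> N (b, h)"
  shows "N (b, c) = {(b, b), (c, b)}" "N (c, b) = {(c, c), (b, c)}"
    "N (c, a) = {(c, h), (a, c)}" "N (c, h) = {(c, c), (c, a)}"
proof -
  have verts: "h \<in> pverts G" "a \<in> pverts G" "b \<in> pverts G" "c \<in> pverts G"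
    and dist: "distinct [h, a, b, c]"
    using sq by (auto simp: pendant_square_def)
  note diag = square_diagonal[OF sq] and sub = square_nbrs[OF sq]
  have "(b, h) \<notin> N (b, c)"
    using unused nbrs_sym by blast
  then show 1: "N (b, c) = {(b, b), (c, b)}"
    using sub(3)[of b] verts by (intro nbrs_eq_if_subset) (auto simp: verts_iff)
  show 2: "N (c, b) = {(c, c), (b, c)}"
    using 1 diag(3) verts dist by (intro nbrs_eqI) (auto simp: verts_iff)
  have "(c, b) \<notin> N (c, a)"
    using 2 dist by (auto simp: nbrs_commute[of _ "(c, a)"])
  then show 3: "N (c, a) = {(c, h), (a, c)}"
    using sub(1)[of c] verts by (intro nbrs_eq_if_subset) (auto simp: verts_iff)
  show "N (c, h) = {(c, c), (c, a)}"
    using 3 diag(3) verts dist by (intro nbrs_eqI) (auto simp: verts_iff)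
qed

text \<open>If both alternatives fail, \<open>square_block_forced\<close> and its mirror image
  exchanging \<open>a\<close> and \<open>c\<close> join \<open>(b, h)\<close> to
  \<open>(b, a)\<close> and \<open>(b, c)\<close>, which \<open>no_square\<close> excludes.\<close>

lemma square_saturates:
  assumes sq: "pendant_square G h a b c"
  shows "N (a, h) = {(a, a), (a, c)} \<or> N (c, h) = {(c, c), (c, a)}"
proof (rule ccontr)
  assume "\<not> ?thesis"
  then have "(b, a) \<in> N (b, h)" "(b, c) \<in> N (b, h)"
    using square_block_forced(4)[OF sq] square_block_forced(4)[of h c b a] sq
    by (auto simp: pendant_square_commute[of _ _ c])
  moreover have "b \<in> pverts G" "b \<noteq> h"
    using sq by (auto simp: pendant_square_def)
  ultimately show False
    using no_square[OF sq] square_diagonal(2)[OF sq] by blast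
qed

section \<open>Interaction of the two 4-cycles\<close>

lemma two_squares_contradiction:
  assumes sq: "pendant_square G h a b c" and sq': "pendant_square G h d e f"
    and dist': "distinct [h, a, b, c, d, e, f]"
    and sat: "N (a, h) = {(a, a), (a, c)}" and sat': "N (d, h) = {(d, d), (d, f)}"
  shows False
proof -
  have verts: "h \<in> pverts G" "a \<in> pverts G" "b \<in> pverts G" "c \<in> pverts G"
    "d \<in> pverts G" "e \<in> pverts G" "f \<in> pverts G"
    using sq sq' by (auto simp: pendant_square_def)
  note sub = square_nbrs[OF sq] and sub' = square_nbrs[OF sq']
  have "(a, h) \<notin> N (h, a)" "(d, h) \<notin> N (h, d)"
    using sat sat' dist' by (auto simp: nbrs_commute[of _ "(h, _)"])
  then have ha: "N (h, a) = {(h, b), (h, h)}" and hd: "N (h, d) = {(h, e), (h, h)}"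
    using sub(1)[of h] sub'(1)[of h] verts
    by (auto intro!: nbrs_eq_if_subset simp: verts_iff)
  have hh: "N (h, h) = {(h, a), (h, d)}"
    using ha hd verts dist' by (intro nbrs_eqI) (auto simp: verts_iff)
  have "(h, h) \<notin> N (h, c)"
    using hh dist' by (auto simp: nbrs_commute[of _ "(h, c)"])
  then have hc: "N (h, c) = {(h, b), (c, h)}"
    using sub(3)[of h] verts by (intro nbrs_eq_if_subset) (auto simp: verts_iff)
  have ch: "N (c, h) = {(c, c), (h, c)}"
    using hc square_diagonal(3)[OF sq] verts dist'
    by (intro nbrs_eqI) (auto simp: verts_iff)
  \<comment> \<open>Without \<open>(v, h)\<close>, both \<open>(v, d)\<close> and
    \<open>(v, f)\<close> need \<open>(v, e)\<close>, which then has no edge left for the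
    swap.\<close>
  have no_swap: "(v, e) \<notin> N (e, v)"
    if v: "v \<in> pverts G" "v \<notin> {d, e, f}" and out: "(v, d) \<notin> N (v, h)" "(v, f) \<notin> N (v, h)" for v
  proof -
    have "N (v, d) = {(v, e), (d, v)}" "N (v, f) = {(v, e), (f, v)}"
      using sub'(1)[of v] sub'(3)[of v] out v verts
      by (auto intro!: nbrs_eq_if_subset simp: verts_iff nbrs_commute[of _ "(v, h)"])
    then have "N (v, e) = {(v, d), (v, f)}"
      using v verts dist' by (intro nbrs_eqI) (auto simp: verts_iff)
    then show ?thesis
      using v by (auto simp: nbrs_commute[of _ "(e, v)"])
  qed
  \<comment> \<open>Both edges at \<open>(a, h)\<close> and at \<open>(c, h)\<close> are known by
    now, and none leads to second coordinate \<open>d\<close> or \<open>f\<close>.\<close>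
  have "(a, e) \<notin> N (e, a)" "(c, e) \<notin> N (e, c)"
    using no_swap[of a] no_swap[of c] sat ch verts dist' by auto
  then have ea: "N (e, a) = {(e, b), (e, h)}" and ec: "N (e, c) = {(e, b), (e, h)}"
    using sub(1)[of e] sub(3)[of e] verts
      nbrs_eq_if_subset[of "(e, a)" "(e, b)" "(e, h)"]
      nbrs_eq_if_subset[of "(e, c)" "(e, b)" "(e, h)"]
    by (simp_all add: verts_iff) blast+
  then have "N (e, b) = {(e, a), (e, c)}"
    using verts dist' by (intro nbrs_eqI) (auto simp: verts_iff)
  moreover have "(e, a) \<in> N (e, h)" "(e, c) \<in> N (e, h)"
    using ea ec by (simp_all add: nbrs_commute[of _ "(e, h)"])
  ultimately show False
    using no_square[OF sq, of e] verts dist' by auto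
qed

end

theorem mainTheorem4:
  shows "\<not> hamiltonian (OTIS bowtie44)"
proof
  assume "hamiltonian (OTIS bowtie44)"
  then obtain N where "connected_two_factor (OTIS bowtie44) N"
    using hamiltonian_imp_connected_two_factor pair_graph_OTIS pair_graph_bowtie44 by blast
  then interpret otis_two_factor bowtie44 N
    by (simp add: otis_two_factor_def)
  have sq: "pendant_square bowtie44 4 1 2 3" "pendant_square bowtie44 4 3 2 1"
    "pendant_square bowtie44 4 5 6 7" "pendant_square bowtie44 4 7 6 5"
    unfolding pendant_square_def bowtie44_def symcl_def by auto
  \<comment> \<open>Each square is saturated at one of the two vertices next to \<open>4\<close>;
    the two orientations of each square in \<open>sq\<close> cover all four combinations.\<close>
  show False
    using square_saturates[OF sq(1)] square_saturates[OF sq(3)]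
      two_squares_contradiction[OF sq(1,3)] two_squares_contradiction[OF sq(1,4)]
      two_squares_contradiction[OF sq(2,3)] two_squares_contradiction[OF sq(2,4)]
    by auto
qed

end
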